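(* Let $H=(A\cup B,E)$ be a bipartite graph such that $\binom{|A|}{r}\binom{r}{k}$ divides $d_k$ for each $1\le k\le r$, where $d_k$ is the number of vertices of degree $k$ in $B$ and $r$ is the maximum degree of vertices in $B$. Then $H$ is a non-trivial square.
   Context: All graphs are finite and simple, without loops or multiple edges. $H=(A\cup B,E)$ bipartite means that $V(H)$ is the disjoint union of $A$ and $B$ and every edge joins a vertex of $A$ to a vertex of $B$. A partially labeled graph is a graph in which some (possibly none, possibly all) vertices carry labels from $\mathbb{N}=\{1,2,3,\dots\}$, no two vertices having the same label and no vertex having more than one label. The product $F_1F_2$ of two partially labeled graphs is obtained by taking their disjoint union, gluing together vertices with the same label, and keeping only one copy of any doubled edge; $F^2=FF$. For a partially labeled graph $F$, $[[F]]$ is the unlabeled graph obtained by removing all labels. Equality of unlabeled graphs means isomorphism. An unlabeled graph $H$ is a trivial square if whenever $H=[[F^2]]$ for a partially labeled graph $F$, then $F$ is a fully labeled copy of $H$. Otherwise $H$ is a non-trivial square.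
   Formalization: The formal theorem additionally assumes that H has at least 2 vertices and is not a graph with exactly one edge and at most 3 vertices; this excludes only K_0, K_1, K_2 and K_2+K_1, all trivial squares for which the claim as stated fails. *)

theory Defs
  imports Main
begin

record 'a sgraph =
  verts :: "'a set"
  edges :: "'a set set"

definition simple_graph :: "('a, 'm) sgraph_scheme \<Rightarrow> bool" where
  "simple_graph G \<longleftrightarrow> finite (verts G) \<and> (\<forall>e\<in>edges G. e \<subseteq> verts G \<and> card e = 2)"

definition degree :: "('a, 'm) sgraph_scheme \<Rightarrow> 'a \<Rightarrow> nat" where
  "degree G v = card {e \<in> edges G. v \<in> e}"

definition bipartite :: "('a, 'm) sgraph_scheme \<Rightarrow> 'a set \<Rightarrow> 'a set \<Rightarrow> bool" where
  "bipartite G A B \<longleftrightarrow>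
     verts G = A \<union> B \<and> A \<inter> B = {} \<and> (\<forall>e\<in>edges G. \<exists>a\<in>A. \<exists>b\<in>B. e = {a, b})"

definition isomorphic :: "('a, 'm) sgraph_scheme \<Rightarrow> ('b, 'n) sgraph_scheme \<Rightarrow> bool" where
  "isomorphic G H \<longleftrightarrow>
     (\<exists>f. bij_betw f (verts G) (verts H) \<and>
          (\<forall>u\<in>verts G. \<forall>v\<in>verts G. {u, v} \<in> edges G \<longleftrightarrow> {f u, f v} \<in> edges H))"

record 'a plgraph = "'a sgraph" +
  label :: "'a \<Rightarrow> nat option"

text \<open>Labels are positive integers, so the label 0 is excluded.\<close>

definition partially_labeled_graph :: "'a plgraph \<Rightarrow> bool" where
  "partially_labeled_graph F \<longleftrightarrow>
     simple_graph F \<and>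
     (\<forall>v\<in>verts F. label F v \<noteq> Some 0) \<and>
     (\<forall>u\<in>verts F. \<forall>v\<in>verts F. label F u \<noteq> None \<and> label F u = label F v \<longrightarrow> u = v)"

definition fully_labeled :: "'a plgraph \<Rightarrow> bool" where
  "fully_labeled F \<longleftrightarrow> (\<forall>v\<in>verts F. label F v \<noteq> None)"

definition unlabel :: "'a plgraph \<Rightarrow> 'a sgraph" where
  "unlabel F = \<lparr>verts = verts F, edges = edges F\<rparr>"

text \<open>
  A vertex of the product of two partially labeled graphs is either a label occurring in at
  least one of the factors, or an unlabeled vertex of the first or of the second factor.
  Representing a labeled vertex by its label is what glues vertices with equal labels; as
  edges form a set, doubled edges are merged.
\<close>

datatype ('a, 'b) glued = Labeled nat | Fst 'a | Snd 'b

definition in_fst :: "'a plgraph \<Rightarrow> 'a \<Rightarrow> ('a, 'b) glued" where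
  "in_fst F v = (case label F v of Some l \<Rightarrow> Labeled l | None \<Rightarrow> Fst v)"

definition in_snd :: "'b plgraph \<Rightarrow> 'b \<Rightarrow> ('a, 'b) glued" where
  "in_snd F v = (case label F v of Some l \<Rightarrow> Labeled l | None \<Rightarrow> Snd v)"

definition plg_product :: "'a plgraph \<Rightarrow> 'b plgraph \<Rightarrow> ('a, 'b) glued plgraph" where
  "plg_product F G =
     \<lparr>verts = in_fst F ` verts F \<union> in_snd G ` verts G,
      edges = (\<lambda>e. in_fst F ` e) ` edges F \<union> (\<lambda>e. in_snd G ` e) ` edges G,
      label = (\<lambda>x. case x of Labeled l \<Rightarrow> Some l | _ \<Rightarrow> None)\<rparr>"

text \<open>
  The factor \<open>F\<close> ranges over graphs whose vertices are natural numbers. This is no loss of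
  generality, since every finite partially labeled graph is isomorphic to one of these.
\<close>

definition trivial_square :: "'a sgraph \<Rightarrow> bool" where
  "trivial_square H \<longleftrightarrow>
     (\<forall>F :: nat plgraph.
        partially_labeled_graph F \<and> isomorphic H (unlabel (plg_product F F)) \<longrightarrow>
        fully_labeled F \<and> isomorphic H (unlabel F))"

definition nontrivial_square :: "'a sgraph \<Rightarrow> bool" where
  "nontrivial_square H \<longleftrightarrow> \<not> trivial_square H"

text \<open>The maximum over an empty set of vertices is read as 0.\<close>

definition max_degree_on :: "('a, 'm) sgraph_scheme \<Rightarrow> 'a set \<Rightarrow> nat" where
  "max_degree_on G B = Max (insert 0 (degree G ` B))"

definition num_of_degree :: "('a, 'm) sgraph_scheme \<Rightarrow> 'a set \<Rightarrow> nat \<Rightarrow> nat" where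
  "num_of_degree G B k = card {b \<in> B. degree G b = k}"

end

theory Submission
  imports Defs "HOL-Combinatorics.Transposition"
begin

text \<open>
  A graph is a non-trivial square as soon as it has a mirror symmetry: an involutive automorphism
  whose moved vertices split into a non-empty half and its mirror image, with no edge joining the
  two halves. Keeping one half together with the fixed vertices, and labelling exactly the fixed
  vertices, gives a factor \<open>F\<close> whose square is the graph
  (\<open>mirror_symmetry_imp_nontrivial_square\<close>).

  Two vertices with the same neighbourhood are exchanged by such a symmetry
  (\<open>twins_imp_nontrivial_square\<close>), so assume that there are no such twins. Then a vertex
  of \<open>B\<close> is determined by its neighbourhood, a subset of \<open>A\<close>, and at most \<open>|A| choose k\<close> vertices
  of \<open>B\<close> have degree \<open>k\<close>. Since \<open>(|A| choose r) * (r choose k)\<close> is a multiple of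
  \<open>|A| choose k\<close>, the divisibility hypothesis forces the number of these vertices to be \<open>0\<close> or
  \<open>|A| choose k\<close>: the \<open>k\<close>-subsets of \<open>A\<close> either all occur as neighbourhoods or none does
  (\<open>neighborhoods_all_or_none\<close>). The family of neighbourhoods is thus invariant under every
  permutation of \<open>A\<close>. If \<open>A\<close> has two vertices, their transposition therefore extends to \<open>H\<close>, and it
  is a mirror symmetry, as the only vertices of \<open>B\<close> that it moves are those adjacent to exactly one
  of the two (\<open>transposition_invariant_imp_nontrivial_square\<close>). If \<open>A\<close> has at most one vertex, a
  graph without twins has at most one edge and at most three vertices, which leaves only the
  excluded graphs (\<open>no_twins_small_side\<close>).
\<close>

section \<open>Squares from mirror symmetries\<close>

text \<open>
  The set \<open>X\<close> is one of the two halves exchanged by \<open>\<phi>\<close>; an edge meeting both \<open>X\<close> and its image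
  could not come from either copy of the factor.
\<close>

definition mirror_symmetry :: "'a sgraph \<Rightarrow> ('a \<Rightarrow> 'a) \<Rightarrow> 'a set \<Rightarrow> bool" where
  "mirror_symmetry H \<phi> X \<longleftrightarrow>
     \<phi> ` verts H \<subseteq> verts H \<and> (\<forall>v\<in>verts H. \<phi> (\<phi> v) = v) \<and>
     (\<forall>e\<in>edges H. \<phi> ` e \<in> edges H) \<and>
     X \<subseteq> verts H \<and> X \<noteq> {} \<and> X \<inter> \<phi> ` X = {} \<and>
     (\<forall>v\<in>verts H - X - \<phi> ` X. \<phi> v = v) \<and>
     (\<forall>e\<in>edges H. e \<inter> X = {} \<or> e \<inter> \<phi> ` X = {})"

text \<open>
  The isomorphism onto the square sends the fixed vertices to labels, the vertices of \<open>X\<close> to the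
  first copy of the factor and the vertices of \<open>\<phi> ` X\<close>, reflected, to the second copy.
\<close>

lemma mirror_symmetry_imp_nontrivial_square:
  assumes simple: "simple_graph H" and mirror: "mirror_symmetry H \<phi> X"
  shows "nontrivial_square H"
proof -
  define V where "V = verts H"
  define Y where "Y = \<phi> ` X"
  define L where "L = V - X - Y"
  note mirror' = mirror[unfolded mirror_symmetry_def, folded V_def Y_def, folded L_def]
  have phiV: "\<And>v. v \<in> V \<Longrightarrow> \<phi> v \<in> V" and inv: "\<And>v. v \<in> V \<Longrightarrow> \<phi> (\<phi> v) = v"
    and phiE: "\<And>e. e \<in> edges H \<Longrightarrow> \<phi> ` e \<in> edges H"
    and X: "X \<subseteq> V" "X \<noteq> {}" "X \<inter> Y = {}"
    and fixL: "\<And>v. v \<in> L \<Longrightarrow> \<phi> v = v"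
    and sep: "\<And>e. e \<in> edges H \<Longrightarrow> e \<inter> X = {} \<or> e \<inter> Y = {}"
    using mirror' by (simp_all only: image_subset_iff simp_thms)
  have Y: "Y \<subseteq> V" using X phiV by (auto simp: Y_def)
  have phiY: "\<And>v. v \<in> Y \<Longrightarrow> \<phi> v \<in> X" using X inv by (auto simp: Y_def)
  have V_split: "V = L \<union> X \<union> Y" "L \<inter> X = {}" "L \<inter> Y = {}" using X Y by (auto simp: L_def)
  have finV: "finite V" and edgeV: "\<And>e. e \<in> edges H \<Longrightarrow> e \<subseteq> V \<and> card e = 2"
    using simple by (auto simp: simple_graph_def V_def)
  \<comment> \<open>A numbering of the vertices serves both as vertex names of the factor and, shifted past
    the excluded label 0, as labels.\<close>
  obtain g :: "'a \<Rightarrow> nat" where g: "inj_on g V"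
    using finite_imp_inj_to_nat_seg[OF finV] by blast
  have g_eq: "\<And>u v. u \<in> V \<Longrightarrow> v \<in> V \<Longrightarrow> g u = g v \<longleftrightarrow> u = v" using g by (auto dest: inj_onD)
  define EF where "EF = {e \<in> edges H. e \<subseteq> L \<union> X}"
  define F :: "nat plgraph" where
    "F = \<lparr>verts = g ` (L \<union> X), edges = (`) g ` EF,
          label = (\<lambda>n. if n \<in> g ` L then Some (Suc n) else None)\<rparr>"
  have gL: "\<And>v. v \<in> V \<Longrightarrow> g v \<in> g ` L \<longleftrightarrow> v \<in> L" using V_split g_eq by (auto simp: image_iff)
  have "card (g ` e) = 2" if "e \<in> EF" for e
    using that edgeV g by (metis (no_types, lifting) EF_def card_image inj_on_subset mem_Collect_eq)
  then have plF: "partially_labeled_graph F"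
    using finV V_split by (auto simp: partially_labeled_graph_def simple_graph_def F_def EF_def)
  define f :: "'a \<Rightarrow> (nat, nat) glued" where
    "f v = (if v \<in> L then Labeled (Suc (g v)) else if v \<in> X then Fst (g v) else Snd (g (\<phi> v)))" for v
  have f_fst: "in_fst F (g v) = f v" if "v \<in> L \<union> X" for v
    using that V_split gL by (auto simp: in_fst_def F_def f_def)
  have f_snd: "in_snd F (g v) = f (\<phi> v)" if "v \<in> L \<union> X" for v
  proof (cases "v \<in> L")
    case True
    then show ?thesis using fixL by (auto simp: in_snd_def F_def f_def)
  next
    case False
    then have "v \<in> X" "\<phi> v \<in> Y" "v \<in> V" using that X by (auto simp: Y_def)
    then show ?thesis using False V_split X inv gL by (auto simp: in_snd_def F_def f_def)
  qed
  have inj_f: "inj_on f V"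
  proof (rule inj_onI)
    fix u v assume uv: "u \<in> V" "v \<in> V" "f u = f v"
    then show "u = v"
      using g_eq phiV inv by (auto simp: f_def split: if_splits) metis
  qed
  have phi_LX: "\<phi> ` (L \<union> X) = L \<union> Y" using fixL by (simp add: image_Un Y_def)
  have vertsP: "verts (plg_product F F) = f ` V"
  proof -
    have "verts (plg_product F F) = in_fst F ` g ` (L \<union> X) \<union> in_snd F ` g ` (L \<union> X)"
      by (simp add: plg_product_def F_def)
    also have "in_fst F ` g ` (L \<union> X) = f ` (L \<union> X)"
      by (simp only: image_image f_fst cong: image_cong)
    also have "in_snd F ` g ` (L \<union> X) = f ` (\<phi> ` (L \<union> X))"
      by (simp only: image_image f_snd cong: image_cong)
    finally show ?thesis using V_split phi_LX by auto
  qed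
  have edgesP: "edges (plg_product F F) = (`) f ` edges H"
  proof -
    have 1: "in_fst F ` g ` e = f ` e" if "e \<in> EF" for e
      unfolding image_image by (rule image_cong) (use that f_fst in \<open>auto simp: EF_def\<close>)
    have 2: "in_snd F ` g ` e = f ` (\<phi> ` e)" if "e \<in> EF" for e
      unfolding image_image by (rule image_cong) (use that f_snd in \<open>auto simp: EF_def\<close>)
    have "edges (plg_product F F) =
        (\<lambda>e. in_fst F ` g ` e) ` EF \<union> (\<lambda>e. in_snd F ` g ` e) ` EF"
      by (simp add: plg_product_def F_def image_image)
    also have "\<dots> = (`) f ` EF \<union> (`) f ` ((`) \<phi> ` EF)"
      using 1 2 by (simp add: image_image[of "(`) f" "(`) \<phi>"] cong: image_cong)
    also have "\<dots> = (`) f ` (EF \<union> (`) \<phi> ` EF)" by (simp add: image_Un)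
    also have "EF \<union> (`) \<phi> ` EF = edges H"
    proof
      show "EF \<union> (`) \<phi> ` EF \<subseteq> edges H" using phiE by (auto simp: EF_def)
      show "edges H \<subseteq> EF \<union> (`) \<phi> ` EF"
      proof
        fix e assume e: "e \<in> edges H"
        show "e \<in> EF \<union> (`) \<phi> ` EF"
        proof (cases "e \<inter> Y = {}")
          case True
          then show ?thesis using e edgeV V_split by (auto simp: EF_def)
        next
          case False
          then have "e \<subseteq> L \<union> Y" using sep[OF e] edgeV[OF e] V_split by auto
          then have "\<phi> ` e \<subseteq> L \<union> X" using fixL phiY by auto
          then have "\<phi> ` e \<in> EF" using phiE[OF e] by (simp add: EF_def)
          moreover have "\<phi> ` \<phi> ` e = e" using inv edgeV[OF e] by (force simp: image_image)
          ultimately show ?thesis by (metis UnI2 imageI)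
        qed
      qed
    qed
    finally show ?thesis .
  qed
  have edge_iff: "{f u, f v} \<in> (`) f ` edges H \<longleftrightarrow> {u, v} \<in> edges H" if "u \<in> V" "v \<in> V" for u v
  proof
    assume "{f u, f v} \<in> (`) f ` edges H"
    then obtain e where "e \<in> edges H" "f ` {u, v} = f ` e" by auto
    moreover from this have "{u, v} = e"
      using inj_on_image_eq_iff[OF inj_f, of "{u, v}" e] edgeV that by auto
    ultimately show "{u, v} \<in> edges H" by simp
  next
    assume "{u, v} \<in> edges H"
    then have "f ` {u, v} \<in> (`) f ` edges H" by (rule imageI)
    then show "{f u, f v} \<in> (`) f ` edges H" by simp
  qed
  have "isomorphic H (unlabel (plg_product F F))"
    unfolding isomorphic_def
  proof (intro exI conjI ballI)
    show "bij_betw f (verts H) (verts (unlabel (plg_product F F)))"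
      using inj_f vertsP by (simp add: bij_betw_def unlabel_def V_def)
    show "{u, v} \<in> edges H \<longleftrightarrow> {f u, f v} \<in> edges (unlabel (plg_product F F))"
      if "u \<in> verts H" "v \<in> verts H" for u v
      using edge_iff that edgesP by (simp add: unlabel_def V_def)
  qed
  moreover have "\<not> fully_labeled F"
  proof -
    obtain x where x: "x \<in> X" using X by auto
    then have "g x \<in> verts F" "label F (g x) = None"
      using gL V_split by (auto simp: F_def)
    then show ?thesis by (auto simp: fully_labeled_def)
  qed
  ultimately show ?thesis using plF unfolding nontrivial_square_def trivial_square_def by blast
qed

section \<open>Neighbourhoods and twins\<close>

definition nbhd :: "'a sgraph \<Rightarrow> 'a \<Rightarrow> 'a set" where
  "nbhd G v = {u. {u, v} \<in> edges G}"

lemma nbhd_commute: "u \<in> nbhd G v \<longleftrightarrow> v \<in> nbhd G u"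
  by (simp add: nbhd_def insert_commute)

lemma degree_eq_card_nbhd:
  assumes "simple_graph G"
  shows "degree G v = card (nbhd G v)"
proof -
  have "{e \<in> edges G. v \<in> e} = (\<lambda>u. {u, v}) ` nbhd G v"
  proof -
    have "\<exists>u. e = {u, v}" if "e \<in> edges G" "v \<in> e" for e
      using assms that by (auto simp: simple_graph_def card_2_iff)
    then show ?thesis by (auto simp: nbhd_def)
  qed
  moreover have "inj_on (\<lambda>u. {u, v}) (nbhd G v)"
    by (auto simp: inj_on_def doubleton_eq_iff)
  ultimately show ?thesis by (simp add: degree_def card_image)
qed

lemma simple_graph_edge_cases:
  assumes "simple_graph G" "e \<in> edges G"
  obtains u v where "e = {u, v}" "u \<noteq> v" "u \<in> verts G" "v \<in> verts G" "u \<in> nbhd G v"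
proof -
  obtain u v where uv: "e = {u, v}" "u \<noteq> v" "e \<subseteq> verts G"
    using assms unfolding simple_graph_def card_2_iff by metis
  then show thesis using that[of u v] assms(2) by (simp add: nbhd_def)
qed

lemma not_in_own_nbhd: "simple_graph G \<Longrightarrow> v \<notin> nbhd G v"
  by (auto simp: simple_graph_def nbhd_def)

lemma twins_imp_nontrivial_square:
  assumes simple: "simple_graph H"
    and xy: "x \<in> verts H" "y \<in> verts H" "x \<noteq> y" "nbhd H x = nbhd H y"
  shows "nontrivial_square H"
proof (rule mirror_symmetry_imp_nontrivial_square[OF simple])
  let ?t = "transpose x y"
  have nbhd_t: "nbhd H (?t v) = nbhd H v" for v
    using xy by (auto simp: transpose_def)
  have edges_t: "?t ` e \<in> edges H" if e: "e \<in> edges H" for e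
  proof -
    obtain u v where uv: "e = {u, v}" "u \<in> nbhd H v"
      using simple_graph_edge_cases[OF simple e] by metis
    then have "?t u \<in> nbhd H (?t v)" using nbhd_t by (metis nbhd_commute)
    then show ?thesis using uv by (simp add: nbhd_def)
  qed
  have "{x, y} \<notin> edges H"
    using xy(4) not_in_own_nbhd[OF simple, of x] unfolding nbhd_def by blast
  then have sep: "e \<inter> {x} = {} \<or> e \<inter> {y} = {}" if e: "e \<in> edges H" for e
  proof -
    obtain u v where "e = {u, v}" using simple_graph_edge_cases[OF simple e] by metis
    then show ?thesis using e \<open>{x, y} \<notin> edges H\<close> xy(3) by (auto simp: insert_commute)
  qed
  have image_x: "?t ` {x} = {y}" by simp
  show "mirror_symmetry H ?t {x}"
    unfolding mirror_symmetry_def image_x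
  proof (intro conjI ballI)
    show "?t ` verts H \<subseteq> verts H" using xy by (auto simp: transpose_def)
    show "?t v = v" if "v \<in> verts H - {x} - {y}" for v
      using that by (simp add: transpose_def)
    show "?t ` e \<in> edges H" "e \<inter> {x} = {} \<or> e \<inter> {y} = {}" if "e \<in> edges H" for e
      using edges_t[OF that] sep[OF that] .
    show "?t (?t v) = v" for v by (rule transpose_involutory)
    show "{x} \<subseteq> verts H" "{x} \<noteq> {}" using xy(1) by blast+
    show "{x} \<inter> {y} = {}" using xy(3) by blast
  qed
qed

section \<open>Bipartite graphs without twins\<close>

lemma bipartite_nbhd_subset:
  assumes "bipartite H A B" "b \<in> B"
  shows "nbhd H b \<subseteq> A"
proof
  fix u assume "u \<in> nbhd H b"
  then obtain a b' where "a \<in> A" "b' \<in> B" "{u, b} = {a, b'}"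
    using assms by (auto simp: bipartite_def nbhd_def)
  then show "u \<in> A" using assms by (auto simp: bipartite_def doubleton_eq_iff)
qed

text \<open>
  An involution of \<open>A\<close> that preserves the family of neighbourhoods extends to an automorphism,
  moving each vertex of \<open>B\<close> to the one whose neighbourhood is the image. For a transposition of
  \<open>x\<close> and \<open>y\<close>, one half of the moved vertices consists of \<open>x\<close> and the neighbours of \<open>x\<close> that are
  not adjacent to \<open>y\<close>.
\<close>

lemma transposition_invariant_imp_nontrivial_square:
  assumes simple: "simple_graph H" and bip: "bipartite H A B"
    and inj: "inj_on (nbhd H) B"
    and xy: "x \<in> A" "y \<in> A" "x \<noteq> y"
    and invariant: "\<And>b. b \<in> B \<Longrightarrow> transpose x y ` nbhd H b \<in> nbhd H ` B"
  shows "nontrivial_square H"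
proof (rule mirror_symmetry_imp_nontrivial_square[OF simple])
  let ?t = "transpose x y"
  define h where "h b = inv_into B (nbhd H) (?t ` nbhd H b)" for b
  define \<phi> where "\<phi> v = (if v \<in> A then ?t v else h v)" for v
  define X where "X = insert x {b \<in> B. x \<in> nbhd H b \<and> y \<notin> nbhd H b}"
  define Y where "Y = insert y {b \<in> B. y \<in> nbhd H b \<and> x \<notin> nbhd H b}"
  have V: "verts H = A \<union> B" and disj: "A \<inter> B = {}"
    and edge: "\<And>e. e \<in> edges H \<Longrightarrow> \<exists>a\<in>A. \<exists>b\<in>B. e = {a, b}"
    using bip by (auto simp: bipartite_def)
  have hB: "h b \<in> B" and nbhd_h: "nbhd H (h b) = ?t ` nbhd H b" if "b \<in> B" for b
    using invariant[OF that] by (auto simp: h_def inv_into_into f_inv_into_f)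
  have tA: "?t a \<in> A" if "a \<in> A" for a using that xy by (auto simp: transpose_def)
  have tt: "?t ` ?t ` S = S" for S by (simp add: image_image)
  have h_eqI: "h b = b'" if "b \<in> B" "b' \<in> B" "nbhd H b' = ?t ` nbhd H b" for b b'
    using inj nbhd_h hB that by (metis inj_onD)
  have hh: "h (h b) = b" if "b \<in> B" for b
    using that hB nbhd_h tt by (intro h_eqI) auto
  have phiA: "\<phi> a = ?t a" if "a \<in> A" for a using that by (simp add: \<phi>_def)
  have phiB: "\<phi> b = h b" if "b \<in> B" for b using that disj by (auto simp: \<phi>_def)
  have mem_t: "a \<in> ?t ` S \<longleftrightarrow> ?t a \<in> S" for a S
    by (metis (no_types, lifting) imageE imageI transpose_involutory)
  have h_X: "h b \<in> Y" if "b \<in> X \<inter> B" for b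
    using that hB nbhd_h xy disj by (auto simp: X_def Y_def mem_t)
  have h_Y: "h b \<in> X" if "b \<in> Y \<inter> B" for b
    using that hB nbhd_h xy disj by (auto simp: X_def Y_def mem_t)
  have phi_X: "\<phi> ` X = Y"
  proof
    show "\<phi> ` X \<subseteq> Y"
      using h_X phiB phiA xy by (auto simp: X_def Y_def)
    show "Y \<subseteq> \<phi> ` X"
    proof
      fix v assume v: "v \<in> Y"
      show "v \<in> \<phi> ` X"
      proof (cases "v = y")
        case True
        then have "v = \<phi> x" using phiA xy by simp
        then show ?thesis by (auto simp: X_def)
      next
        case False
        then have "v \<in> Y \<inter> B" using v by (auto simp: Y_def)
        then have "h v \<in> X" "v = \<phi> (h v)" using h_Y hh hB phiB by auto
        then show ?thesis by blast
      qed
    qed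
  qed
  have fixed: "\<phi> v = v" if "v \<in> verts H - X - Y" for v
  proof (cases "v \<in> A")
    case True
    then show ?thesis using that phiA by (auto simp: X_def Y_def transpose_def)
  next
    case False
    then have v: "v \<in> B" "x \<in> nbhd H v \<longleftrightarrow> y \<in> nbhd H v"
      using that V by (auto simp: X_def Y_def)
    have "nbhd H v = ?t ` nbhd H v"
      using v by (auto simp: mem_t transpose_def)
    then show ?thesis using phiB h_eqI v by auto
  qed
  have phiE: "\<phi> ` e \<in> edges H" if "e \<in> edges H" for e
  proof -
    obtain a b where ab: "a \<in> A" "b \<in> B" "e = {a, b}" using edge[OF \<open>e \<in> edges H\<close>] by auto
    then have "a \<in> nbhd H b" using that by (simp add: nbhd_def)
    then have "?t a \<in> nbhd H (h b)" using nbhd_h ab by simp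
    then show ?thesis using ab phiA phiB by (simp add: nbhd_def)
  qed
  have sep: "e \<inter> X = {} \<or> e \<inter> Y = {}" if "e \<in> edges H" for e
  proof -
    obtain a b where ab: "a \<in> A" "b \<in> B" "e = {a, b}" using edge[OF \<open>e \<in> edges H\<close>] by auto
    then have "a \<in> nbhd H b" using that by (simp add: nbhd_def)
    then show ?thesis using ab xy disj by (auto simp: X_def Y_def)
  qed
  show "mirror_symmetry H \<phi> X"
    unfolding mirror_symmetry_def phi_X
  proof (intro conjI ballI)
    show "\<phi> ` verts H \<subseteq> verts H" using V phiA phiB tA hB by auto
    show "\<phi> (\<phi> v) = v" if "v \<in> verts H" for v
      using that V phiA phiB tA hB hh by auto
    show "X \<subseteq> verts H" "X \<noteq> {}" "X \<inter> Y = {}" using V xy disj by (auto simp: X_def Y_def)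
    show "\<phi> v = v" if "v \<in> verts H - X - Y" for v by (rule fixed[OF that])
    show "\<phi> ` e \<in> edges H" "e \<inter> X = {} \<or> e \<inter> Y = {}" if "e \<in> edges H" for e
      using phiE[OF that] sep[OF that] .
  qed
qed

text \<open>
  Distinct vertices of \<open>B\<close> have distinct neighbourhoods, so at most \<open>|A| choose k\<close> of them have
  degree \<open>k\<close>; their number being a multiple of \<open>|A| choose k\<close>, one occurring neighbourhood of size
  \<open>k\<close> forces all \<open>k\<close>-subsets to occur.
\<close>

lemma neighborhoods_all_or_none:
  assumes simple: "simple_graph H" and bip: "bipartite H A B"
    and inj: "inj_on (nbhd H) B"
    and dvd: "card A choose k dvd num_of_degree H B k"
    and b: "b \<in> B" "degree H b = k" and S: "S \<subseteq> A" "card S = k"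
  shows "S \<in> nbhd H ` B"
proof -
  define D where "D = {b \<in> B. degree H b = k}"
  have "verts H = A \<union> B" using bip by (simp add: bipartite_def)
  then have fin: "finite A" "finite B" using simple by (simp_all add: simple_graph_def)
  have "finite D" "b \<in> D" using fin b by (auto simp: D_def)
  then have "card D \<noteq> 0" by auto
  then have "card A choose k \<le> card D"
    using dvd by (auto simp: num_of_degree_def D_def intro: dvd_imp_le)
  moreover have "card (nbhd H ` D) = card D"
    using inj by (intro card_image inj_on_subset[OF inj]) (auto simp: D_def)
  ultimately have "card {T. T \<subseteq> A \<and> card T = k} \<le> card (nbhd H ` D)"
    using fin by (simp add: n_subsets)
  moreover have "nbhd H ` D \<subseteq> {T. T \<subseteq> A \<and> card T = k}"
    using bipartite_nbhd_subset[OF bip] degree_eq_card_nbhd[OF simple] by (auto simp: D_def)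
  ultimately have "nbhd H ` D = {T. T \<subseteq> A \<and> card T = k}"
    using fin by (intro card_seteq) auto
  then have "S \<in> nbhd H ` D" using S by simp
  then show ?thesis by (auto simp: D_def)
qed

text \<open>
  With at most one vertex in \<open>A\<close>, the only possible neighbourhoods in \<open>B\<close> are the empty set and
  \<open>A\<close>. An edgeless graph with two vertices is excluded because all its vertices are twins.
\<close>

lemma no_twins_small_side:
  assumes simple: "simple_graph H" and bip: "bipartite H A B"
    and inj: "inj_on (nbhd H) (verts H)"
    and A: "card A \<le> 1" and two: "2 \<le> card (verts H)"
  shows "card (edges H) = 1 \<and> card (verts H) \<le> 3"
proof -
  have V: "verts H = A \<union> B" and disj: "A \<inter> B = {}"
    and edge: "\<And>e. e \<in> edges H \<Longrightarrow> \<exists>a\<in>A. \<exists>b\<in>B. e = {a, b}"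
    using bip by (auto simp: bipartite_def)
  have fin: "finite A" "finite B" using simple V by (simp_all add: simple_graph_def)
  have injB: "inj_on (nbhd H) B" using inj V by (auto intro: inj_on_subset)
  have "edges H \<noteq> {}"
  proof
    assume "edges H = {}"
    then have "nbhd H ` verts H \<subseteq> {{}}" by (auto simp: nbhd_def)
    then have "card (nbhd H ` verts H) \<le> 1" using card_mono[of "{{}}" "nbhd H ` verts H"] by simp
    then show False using two card_image[OF inj] by simp
  qed
  then obtain a b where ab: "a \<in> A" "b \<in> B" "{a, b} \<in> edges H" using edge by blast
  have A_eq: "A = {a}"
    using A ab(1) card_le_Suc0_iff_eq[OF fin(1)] by auto
  have nb: "nbhd H c = {a}" if "{a, c} \<in> edges H" "c \<in> B" for c
    using that bipartite_nbhd_subset[OF bip] A_eq by (auto simp: nbhd_def)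
  have "edges H = {{a, b}}"
  proof -
    have "e = {a, b}" if "e \<in> edges H" for e
    proof -
      obtain c where "c \<in> B" "e = {a, c}" using edge[OF \<open>e \<in> edges H\<close>] A_eq by auto
      then show ?thesis using nb ab that injB by (metis inj_onD)
    qed
    then show ?thesis using ab(3) by blast
  qed
  moreover have "card B \<le> 2"
  proof -
    have "nbhd H ` B \<subseteq> Pow A" using bipartite_nbhd_subset[OF bip] by auto
    then have "card (nbhd H ` B) \<le> card (Pow A)" using fin by (intro card_mono) auto
    then show ?thesis using card_image[OF injB] A_eq by (simp add: card_Pow)
  qed
  then have "card (verts H) \<le> 3" using card_Un_le[of A B] A_eq V by simp
  ultimately show ?thesis by simp
qed

section \<open>The divisibility condition\<close>

theorem corollary2p5:
  fixes H :: "'a sgraph" and A B :: "'a set" and r :: nat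
  assumes "simple_graph H" and "bipartite H A B"
    and "r = max_degree_on H B"
    and "\<forall>k. 1 \<le> k \<and> k \<le> r \<longrightarrow> (card A choose r) * (r choose k) dvd num_of_degree H B k"
    and not_K0_K1: "2 \<le> card (verts H)"
    and not_K2_or_K2_plus_K1: "\<not> (card (edges H) = 1 \<and> card (verts H) \<le> 3)"
  shows "nontrivial_square H"
proof (rule ccontr)
  assume trivial: "\<not> nontrivial_square H"
  note simple = assms(1) and bip = assms(2)
  have V: "verts H = A \<union> B" using bip by (simp add: bipartite_def)
  have fin: "finite A" "finite B" using simple V by (simp_all add: simple_graph_def)
  have inj: "inj_on (nbhd H) (verts H)"
    using twins_imp_nontrivial_square[OF simple] trivial by (auto simp: inj_on_def)
  have injB: "inj_on (nbhd H) B" using inj V by (auto intro: inj_on_subset)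
  have deg_le_A: "degree H b \<le> card A" if "b \<in> B" for b
    using card_mono[OF fin(1) bipartite_nbhd_subset[OF bip that]] degree_eq_card_nbhd[OF simple]
    by simp
  have deg_le_r: "degree H b \<le> r" if "b \<in> B" for b
    using that fin by (simp add: assms(3) max_degree_on_def)
  have r_le: "r \<le> card A"
    using fin deg_le_A by (simp add: assms(3) max_degree_on_def)
  have "\<not> card A \<le> 1"
    using no_twins_small_side[OF simple bip inj] assms(5,6) by blast
  then obtain x y where xy: "x \<in> A" "y \<in> A" "x \<noteq> y"
    using fin by (metis One_nat_def card_le_Suc0_iff_eq)
  have "transpose x y ` nbhd H b \<in> nbhd H ` B" if b: "b \<in> B" for b
  proof -
    let ?k = "degree H b" and ?S = "transpose x y ` nbhd H b"
    have "?S \<subseteq> A"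
      using bipartite_nbhd_subset[OF bip b] xy by (auto simp: transpose_def)
    moreover have "card ?S = ?k"
      by (simp add: degree_eq_card_nbhd[OF simple] card_image)
    ultimately have S: "?S \<subseteq> A" "card ?S = ?k" .
    show ?thesis
    proof (cases "?k = 0")
      case True
      \<comment> \<open>Isolated vertices escape the divisibility hypothesis, but their empty neighbourhood is
        invariant.\<close>
      then have "nbhd H b = {}"
        using degree_eq_card_nbhd[OF simple] finite_subset[OF bipartite_nbhd_subset[OF bip b] fin(1)]
        by simp
      then show ?thesis using b by (auto intro!: image_eqI[of _ _ b])
    next
      case False
      have "(card A choose r) * (r choose ?k) = (card A choose ?k) * (card A - ?k choose (r - ?k))"
        using choose_mult deg_le_r[OF b] r_le by blast
      then have "card A choose ?k dvd (card A choose r) * (r choose ?k)" by simp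
      also have "\<dots> dvd num_of_degree H B ?k" using assms(4) False deg_le_r[OF b] by simp
      finally show ?thesis using neighborhoods_all_or_none[OF simple bip injB _ b refl S] by blast
    qed
  qed
  then show False
    using transposition_invariant_imp_nontrivial_square[OF simple bip injB xy] trivial by blast
qed

end
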